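(* There is a constant $c>0$ such that for all sufficiently large integers $n \ge 2$, every $\mathsf{SBC}^-$ proof of the bit pigeonhole principle $\mathrm{BPHP}_n$ has size at least $2^{c n}$; that is, $\mathrm{BPHP}_n$ requires $\mathsf{SBC}^-$ proofs of size $2^{\Omega(n)}$.
   Context: A literal is a variable $v$ or its negation $\bar v$. A clause is a nontautological set of literals (no complementary pair), read as a disjunction; $\bot$ is the empty clause; a formula is a finite set of clauses (a CNF); $\mathrm{var}(\Gamma)$ is the set of variables occurring in $\Gamma$. For a set $L$ of literals, $\bar L=\{\bar\ell:\ell\in L\}$. A clause $D$ is a weakening of $C$ if $C\subseteq D$. If $C\cup\{x\}$ and $D\cup\{\bar x\}$ are clauses with $x,\bar x\notin C\cup D$ and $C\cup D$ nontautological, then $C\cup D$ is their resolvent on $x$. A clause $C$ is a set-blocked clause (SBC) for a nonempty $L\subseteq C$ with respect to a formula $\Gamma$ if for every $D\in\Gamma$ with $D\cap\bar L\neq\varnothing$ and $D\cap L=\varnothing$, the set $(C\setminus L)\cup(D\setminus\bar L)$ is tautological; $C$ is an SBC w.r.t. $\Gamma$ if it is one for some such $L$. An $\mathsf{SBC}$ proof of $\Gamma$ is a sequence of formulas $(\Gamma_1,\dots,\Gamma_N)$ with $\Gamma_1=\Gamma$, $\bot\in\Gamma_N$, and for each $i<N$, $\Gamma_{i+1}=\Gamma_i\cup\{C\}$ where $C$ is a resolvent of two clauses of $\Gamma_i$, a weakening of a clause of $\Gamma_i$, or an SBC with respect to $\Gamma_i$. Its size is $N$. An $\mathsf{SBC}^-$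 proof of $\Gamma$ is an $\mathsf{SBC}$ proof of $\Gamma$ in which every variable occurring anywhere in the proof belongs to $\mathrm{var}(\Gamma)$. Bit pigeonhole principle: for $n=2^k$, $k\ge1$, take variables $p^x_\ell$ for $x\in[n+1]$, $\ell\in[k]$. For a variable $v$, write "$v\neq 0$" for the literal $v$ and "$v\neq1$" for $\bar v$. Then $\mathrm{BPHP}_n$ is the set of clauses $\bigvee_{\ell=1}^k (p^x_\ell\neq h_\ell)\vee\bigvee_{\ell=1}^k(p^y_\ell\neq h_\ell)$ over all $x,y\in[n+1]$ with $x\neq y$ and all $(h_1,\dots,h_k)\in\{0,1\}^k$. For an arbitrary integer $n\ge2$ that is not a power of two, $\mathrm{BPHP}_n$ is defined to be $\mathrm{BPHP}_m$ where $m$ is the largest power of two not exceeding $n$. *)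

theory Defs
  imports Complex_Main "HOL-Library.Discrete_Functions"
begin

datatype 'v literal = Pos (var: 'v) | Neg (var: 'v)

primrec negate :: "'v literal \<Rightarrow> 'v literal" where
  "negate (Pos v) = Neg v"
| "negate (Neg v) = Pos v"

type_synonym 'v clause = "'v literal set"
type_synonym 'v formula = "'v clause set"

definition tautological :: "'v literal set \<Rightarrow> bool" where
  "tautological C \<longleftrightarrow> (\<exists>l\<in>C. negate l \<in> C)"

definition is_clause :: "'v clause \<Rightarrow> bool" where
  "is_clause C \<longleftrightarrow> finite C \<and> \<not> tautological C"

definition is_formula :: "'v formula \<Rightarrow> bool" where
  "is_formula \<Gamma> \<longleftrightarrow> finite \<Gamma> \<and> (\<forall>C\<in>\<Gamma>. is_clause C)"

definition vars :: "'v formula \<Rightarrow> 'v set" where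
  "vars \<Gamma> = (\<Union>C\<in>\<Gamma>. var ` C)"

definition weakening :: "'v clause \<Rightarrow> 'v clause \<Rightarrow> bool" where
  "weakening D C \<longleftrightarrow> is_clause C \<and> is_clause D \<and> C \<subseteq> D"

text \<open>\<open>resolvent E A B\<close>: the clause \<open>E\<close> is a resolvent of \<open>A\<close> and \<open>B\<close>, where \<open>A\<close> is the
  parent that contains the resolved variable positively.\<close>

definition resolvent :: "'v clause \<Rightarrow> 'v clause \<Rightarrow> 'v clause \<Rightarrow> bool" where
  "resolvent E A B \<longleftrightarrow> (\<exists>x C D.
     A = C \<union> {Pos x} \<and> B = D \<union> {Neg x} \<and> is_clause A \<and> is_clause B \<and>
     Pos x \<notin> C \<union> D \<and> Neg x \<notin> C \<union> D \<and> \<not> tautological (C \<union> D) \<and> E = C \<union> D)"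

definition set_blocked_for :: "'v clause \<Rightarrow> 'v literal set \<Rightarrow> 'v formula \<Rightarrow> bool" where
  "set_blocked_for C L \<Gamma> \<longleftrightarrow> is_clause C \<and> L \<noteq> {} \<and> L \<subseteq> C \<and>
     (\<forall>D\<in>\<Gamma>. D \<inter> negate ` L \<noteq> {} \<and> D \<inter> L = {} \<longrightarrow>
        tautological ((C - L) \<union> (D - negate ` L)))"

definition set_blocked :: "'v clause \<Rightarrow> 'v formula \<Rightarrow> bool" where
  "set_blocked C \<Gamma> \<longleftrightarrow> (\<exists>L. set_blocked_for C L \<Gamma>)"

definition SBC_step :: "'v formula \<Rightarrow> 'v formula \<Rightarrow> bool" where
  "SBC_step \<Gamma> \<Gamma>' \<longleftrightarrow> (\<exists>C. \<Gamma>' = \<Gamma> \<union> {C} \<and>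
     ((\<exists>A\<in>\<Gamma>. \<exists>B\<in>\<Gamma>. resolvent C A B) \<or> (\<exists>A\<in>\<Gamma>. weakening C A) \<or> set_blocked C \<Gamma>))"

text \<open>A proof is the list of its formulas; its size is the length of the list.\<close>

definition SBC_proof :: "'v formula \<Rightarrow> 'v formula list \<Rightarrow> bool" where
  "SBC_proof \<Gamma> P \<longleftrightarrow> is_formula \<Gamma> \<and> P \<noteq> [] \<and> hd P = \<Gamma> \<and> {} \<in> last P \<and>
     (\<forall>i. Suc i < length P \<longrightarrow> SBC_step (P ! i) (P ! Suc i))"

definition SBC_minus_proof :: "'v formula \<Rightarrow> 'v formula list \<Rightarrow> bool" where
  "SBC_minus_proof \<Gamma> P \<longleftrightarrow> SBC_proof \<Gamma> P \<and> (\<forall>\<Delta>\<in>set P. vars \<Delta> \<subseteq> vars \<Gamma>)"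

text \<open>The literal \<open>v \<noteq> b\<close>, with \<open>False\<close> and \<open>True\<close> for the bits 0 and 1.\<close>

definition lit_neq :: "'v \<Rightarrow> bool \<Rightarrow> 'v literal" where
  "lit_neq v b = (if b then Neg v else Pos v)"

text \<open>The variable \<open>(x, l)\<close> is bit \<open>l\<close> of the hole assigned to pigeon \<open>x\<close>. A hole is given by
  a function on all of \<open>nat\<close>, of which only the values on \<open>{1..k}\<close> matter; since the clauses
  form a set, functions that agree there contribute the same clause.\<close>

definition BPHP_clause :: "nat \<Rightarrow> nat \<Rightarrow> nat \<Rightarrow> (nat \<Rightarrow> bool) \<Rightarrow> (nat \<times> nat) clause" where
  "BPHP_clause k x y h =
     (\<lambda>l. lit_neq (x, l) (h l)) ` {1..k} \<union> (\<lambda>l. lit_neq (y, l) (h l)) ` {1..k}"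

definition BPHP_pow :: "nat \<Rightarrow> (nat \<times> nat) formula" where
  "BPHP_pow k =
     {BPHP_clause k x y h | x y h. x \<in> {1..2 ^ k + 1} \<and> y \<in> {1..2 ^ k + 1} \<and> x \<noteq> y}"

text \<open>The largest power of two not exceeding \<open>n\<close> is \<open>2 ^ floor_log n\<close>, which is \<open>n\<close> itself when
  \<open>n\<close> is a power of two.\<close>

definition BPHP :: "nat \<Rightarrow> (nat \<times> nat) formula" where
  "BPHP n = BPHP_pow (floor_log n)"

lemma BPHP_power: "BPHP (2 ^ k) = BPHP_pow k"
  by (simp add: BPHP_def)

lemma largest_power_of_two:
  assumes "0 < n"
  shows "Max {m. m \<le> n \<and> (\<exists>k. m = 2 ^ k)} = 2 ^ floor_log n"
proof (rule Max_eqI)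
  show "finite {m. m \<le> n \<and> (\<exists>k. m = 2 ^ k)}" by simp
next
  fix m assume "m \<in> {m. m \<le> n \<and> (\<exists>k. m = 2 ^ k)}"
  then obtain k where k: "m = 2 ^ k" "2 ^ k \<le> n" by auto
  then have "k \<le> floor_log n"
    using floor_log_le_iff[of "2 ^ k" n] by simp
  then show "m \<le> 2 ^ floor_log n" using k by simp
next
  show "2 ^ floor_log n \<in> {m. m \<le> n \<and> (\<exists>k. m = 2 ^ k)}"
    using floor_log_exp2_le[OF assms] by auto
qed

lemma is_clause_BPHP_clause: "x \<noteq> y \<Longrightarrow> is_clause (BPHP_clause k x y h)"
  by (auto simp: is_clause_def tautological_def BPHP_clause_def lit_neq_def split: if_splits)

lemma is_formula_BPHP: "is_formula (BPHP n)"
proof -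
  define k where "k = floor_log n"
  define V where "V = {1..2 ^ k + 1 :: nat} \<times> {1..k}"
  have "BPHP n \<subseteq> Pow (Pos ` V \<union> Neg ` V)"
    unfolding BPHP_def BPHP_pow_def BPHP_clause_def k_def[symmetric] V_def
    by (force simp: lit_neq_def)
  moreover have "finite (Pow (Pos ` V \<union> Neg ` V))"
    by (simp add: V_def)
  ultimately have "finite (BPHP n)"
    by (rule finite_subset)
  then show ?thesis
    by (auto simp: is_formula_def BPHP_def BPHP_pow_def intro: is_clause_BPHP_clause)
qed

end

theory Submission
  imports Defs
begin

text \<open>
  Write \<open>m = 2 ^ k = 4 * q\<close>. A set-blocked clause with respect to any extension of \<open>BPHP\<close>
  mentions every pigeon: if it mentioned \<open>x\<close> through a literal of \<open>L\<close> but not \<open>y\<close>, then an axiom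
  on \<open>x\<close> and \<open>y\<close>, for a hole chosen against the literals of \<open>C\<close> on \<open>x\<close>, would violate
  blockedness. Call a clause wide if it mentions at least \<open>2 * q\<close> pigeons. A partial matching of
  pigeons to holes is built greedily; each assignment of one further pigeon can be chosen to satisfy
  at least a fraction \<open>1/32\<close> of the wide clauses that remain. If a proof has fewer than
  \<open>(32/31) ^ q\<close> formulas, then \<open>q\<close> assignments satisfy all its wide clauses, in particular all
  the set-blocked ones. The remaining clauses are narrow and come from resolution or weakening, so
  by induction along the proof no matching extending the given one falsifies a clause: to pass from
  a narrow resolvent to a parent, a hole is free for the pigeon of the resolved variable. This is
  absurd for the empty clause.
\<close>

lemma in_negate_image: "l \<in> negate ` L \<longleftrightarrow> negate l \<in> L"
proof -
  have invol: "negate (negate m) = m" for m :: "'a literal"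
    by (cases m) simp_all
  then show ?thesis
    by (metis image_iff)
qed

section \<open>Partial matchings and the clauses they satisfy or falsify\<close>

definition pigeons :: "(nat \<times> nat) clause \<Rightarrow> nat set" where
  "pigeons C = (fst \<circ> var) ` C"

text \<open>A hole is encoded by the set of bit positions in which it is 1.\<close>

definition sat_lit :: "nat set \<Rightarrow> (nat \<times> nat) literal \<Rightarrow> bool" where
  "sat_lit H l \<longleftrightarrow> (case l of Pos v \<Rightarrow> snd v \<in> H | Neg v \<Rightarrow> snd v \<notin> H)"

definition satisfies :: "(nat \<rightharpoonup> nat set) \<Rightarrow> (nat \<times> nat) clause \<Rightarrow> bool" where
  "satisfies a C \<longleftrightarrow> (\<exists>l\<in>C. \<exists>H. a (fst (var l)) = Some H \<and> sat_lit H l)"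

text \<open>For partial \<open>a\<close> this is stronger than the negation of
  \<open>satisfies a C\<close>: every pigeon of \<open>C\<close> must have a hole. The empty clause
  is falsified by every \<open>a\<close>.\<close>

definition falsifies :: "(nat \<rightharpoonup> nat set) \<Rightarrow> (nat \<times> nat) clause \<Rightarrow> bool" where
  "falsifies a C \<longleftrightarrow> (\<forall>l\<in>C. \<exists>H. a (fst (var l)) = Some H \<and> \<not> sat_lit H l)"

text \<open>Restricting holes to subsets of \<open>{1..k}\<close> makes the encoding unique, so
  injectivity really means that no two pigeons share a hole.\<close>

definition matching :: "nat \<Rightarrow> (nat \<rightharpoonup> nat set) \<Rightarrow> bool" where
  "matching k a \<longleftrightarrow> dom a \<subseteq> {1..2 ^ k + 1} \<and> ran a \<subseteq> Pow {1..k} \<and> inj_on a (dom a)"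

lemma sat_lit_simps [simp]:
  "sat_lit H (Pos v) \<longleftrightarrow> snd v \<in> H" "sat_lit H (Neg v) \<longleftrightarrow> snd v \<notin> H"
  by (simp_all add: sat_lit_def)

lemma finite_pigeons: "finite C \<Longrightarrow> finite (pigeons C)"
  by (simp add: pigeons_def)

lemma falsifies_mono: "falsifies a C \<Longrightarrow> a \<subseteq>\<^sub>m b \<Longrightarrow> falsifies b C"
  unfolding falsifies_def map_le_def by (metis domI)

lemma falsifies_restrict: "falsifies a C \<Longrightarrow> pigeons C \<subseteq> X \<Longrightarrow> falsifies (a |` X) C"
  unfolding falsifies_def pigeons_def by (force simp: restrict_map_def)

lemma not_satisfies_if_falsifies:
  assumes "falsifies a C" "r \<subseteq>\<^sub>m a"
  shows "\<not> satisfies r C"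
proof
  assume "satisfies r C"
  then obtain l H where l: "l \<in> C" "r (fst (var l)) = Some H" "sat_lit H l"
    by (auto simp: satisfies_def)
  then have "a (fst (var l)) = Some H"
    using assms(2) unfolding map_le_def by (metis domI)
  then show False
    using assms(1) l by (auto simp: falsifies_def)
qed

lemma satisfies_upd:
  "r x = None \<Longrightarrow>
    satisfies (r(x \<mapsto> H)) C \<longleftrightarrow> satisfies r C \<or> (\<exists>l\<in>C. fst (var l) = x \<and> sat_lit H l)"
proof -
  assume "r x = None"
  then have "(\<exists>G. (r(x \<mapsto> H)) (fst (var l)) = Some G \<and> sat_lit G l) \<longleftrightarrow>
      (\<exists>G. r (fst (var l)) = Some G \<and> sat_lit G l) \<or> (fst (var l) = x \<and> sat_lit H l)" for l
    by auto
  then show ?thesis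
    unfolding satisfies_def by blast
qed

lemma finite_dom_matching: "matching k a \<Longrightarrow> finite (dom a)"
  unfolding matching_def by (meson finite_atLeastAtMost finite_subset)

lemma card_ran_le_dom: "finite (dom a) \<Longrightarrow> finite (ran a) \<and> card (ran a) \<le> card (dom a)"
proof -
  assume fin: "finite (dom a)"
  have "ran a = (the \<circ> a) ` dom a"
    by (force simp: ran_def)
  then show ?thesis
    using fin card_image_le by auto
qed

lemma matching_restrict: "matching k a \<Longrightarrow> matching k (a |` X)"
proof -
  assume a: "matching k a"
  have "ran (a |` X) \<subseteq> ran a"
    by (auto simp: restrict_map_def ran_def split: if_splits)
  moreover have "inj_on (a |` X) (dom a \<inter> X)"
    using a unfolding matching_def inj_on_def by simp
  ultimately show ?thesis
    using a unfolding matching_def by auto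
qed

lemma matching_upd:
  assumes "matching k a" "x \<in> {1..2 ^ k + 1}" "x \<notin> dom a" "H \<in> Pow {1..k}" "H \<notin> ran a"
  shows "matching k (a(x \<mapsto> H))"
proof -
  have "inj_on (a(x \<mapsto> H)) (insert x (dom a))"
    using assms(1,3,5) by (auto simp: matching_def inj_on_def ran_def)
  moreover have "ran (a(x \<mapsto> H)) = insert H (ran a)"
    using assms(3) by (simp add: domIff)
  ultimately show ?thesis
    using assms by (auto simp: matching_def)
qed

lemma ex_free_hole:
  assumes "matching k a" "card (dom a) < 2 ^ k"
  obtains H where "H \<in> Pow {1..k}" "H \<notin> ran a"
proof -
  have "card (ran a) < card (Pow {1..k})"
    using card_ran_le_dom[OF finite_dom_matching[OF assms(1)]] assms(2) by (simp add: card_Pow)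
  then have "\<not> Pow {1..k} \<subseteq> ran a"
    using card_ran_le_dom[OF finite_dom_matching[OF assms(1)]] by (meson card_mono not_less)
  then show ?thesis
    using that by blast
qed

text \<open>Falsifying both halves of an axiom puts both of its pigeons into the hole coded by
  \<open>h\<close>, against injectivity.\<close>

lemma matching_not_falsifies_axiom:
  assumes "matching k a" "C \<in> BPHP_pow k" "k \<ge> 1"
  shows "\<not> falsifies a C"
proof
  assume f: "falsifies a C"
  obtain x y h where C: "C = BPHP_clause k x y h" and xy: "x \<noteq> y" "x \<in> {1..2^k+1}"
    using assms(2) by (auto simp: BPHP_pow_def)
  have hole: "a z = Some {l \<in> {1..k}. h l}" if z: "z \<in> {x, y}" for z
  proof -
    have lit: "\<exists>H. a z = Some H \<and> (l \<in> H \<longleftrightarrow> h l)" if "l \<in> {1..k}" for l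
    proof -
      have "lit_neq (z, l) (h l) \<in> C"
        using z that by (auto simp: C BPHP_clause_def)
      then show ?thesis
        using f by (cases "h l") (force simp: falsifies_def lit_neq_def)+
    qed
    \<comment> \<open>One existing bit suffices to show that pigeon \<open>z\<close> has a hole at
      all.\<close>
    from lit[of 1] \<open>k \<ge> 1\<close> obtain H where H: "a z = Some H"
      by auto
    have "H \<subseteq> {1..k}"
      using H assms(1) by (auto simp: matching_def ran_def)
    then have "H = {l \<in> {1..k}. h l}"
      using lit H by auto
    then show ?thesis
      using H by simp
  qed
  then have "a x = a y" "x \<in> dom a" "y \<in> dom a"
    by auto
  then show False
    using assms(1) xy by (auto simp: matching_def inj_on_def)
qed

section \<open>Set-blocked clauses mention every pigeon\<close>

lemma vars_BPHP_pow: "vars (BPHP_pow k) \<subseteq> {1..2 ^ k + 1} \<times> {1..k}"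
proof
  fix v assume "v \<in> vars (BPHP_pow k)"
  then obtain x y h where "v \<in> var ` BPHP_clause k x y h"
    "x \<in> {1..2 ^ k + 1}" "y \<in> {1..2 ^ k + 1}"
    unfolding vars_def BPHP_pow_def by blast
  moreover have "var (lit_neq u b) = u" for u :: "nat \<times> nat" and b
    by (simp add: lit_neq_def)
  ultimately show "v \<in> {1..2 ^ k + 1} \<times> {1..k}"
    by (auto simp: BPHP_clause_def image_Un image_image)
qed

lemma pigeons_set_blocked:
  assumes blocked: "set_blocked C \<Gamma>" and sub: "BPHP_pow k \<subseteq> \<Gamma>"
    and vars: "var ` C \<subseteq> {1..2 ^ k + 1} \<times> {1..k}"
  shows "{1..2 ^ k + 1} \<subseteq> pigeons C"
proof
  fix y :: nat assume y: "y \<in> {1..2 ^ k + 1}"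
  obtain L where "set_blocked_for C L \<Gamma>"
    using blocked unfolding set_blocked_def by blast
  then have C: "is_clause C" and L: "L \<noteq> {}" "L \<subseteq> C" and
    block: "\<And>D. D \<in> \<Gamma> \<Longrightarrow> D \<inter> negate ` L \<noteq> {} \<Longrightarrow> D \<inter> L = {} \<Longrightarrow>
        tautological ((C - L) \<union> (D - negate ` L))"
    unfolding set_blocked_for_def by simp_all
  have nt: "\<not> (Pos v \<in> C \<and> Neg v \<in> C)" for v
    using C unfolding is_clause_def tautological_def by (metis negate.simps(1))
  show "y \<in> pigeons C"
  proof (rule ccontr)
    assume ny: "y \<notin> pigeons C"
    have noty: "Pos (y, l) \<notin> C" "Neg (y, l) \<notin> C" for l
      using ny by (force simp: pigeons_def)+
    obtain lit where lit: "lit \<in> L"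
      using L by auto
    obtain x b where v: "var lit = (x, b)"
      by fastforce
    have xb: "x \<in> {1..2 ^ k + 1}" "b \<in> {1..k}"
      using vars lit L v by force+
    have "x \<noteq> y"
      using noty lit L v by (cases lit) auto
    \<comment> \<open>With this hole, the half of the axiom on \<open>x\<close> contains the
      negation of every literal of \<open>L\<close> on \<open>x\<close> (bits in
      \<open>{1..k}\<close>) and agrees with every literal of \<open>C - L\<close> on
      \<open>x\<close>. As \<open>C\<close> does not mention \<open>y\<close>, the other half
      clashes with nothing.\<close>
    define h where "h l \<longleftrightarrow> Pos (x, l) \<in> L \<or> Neg (x, l) \<in> C - L" for l
    define D where "D = BPHP_clause k x y h"
    have D: "D \<in> \<Gamma>"
      using sub xb(1) y \<open>x \<noteq> y\<close> by (auto simp: D_def BPHP_pow_def)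
    have inD: "Pos (z, l) \<in> D \<longleftrightarrow> z \<in> {x, y} \<and> l \<in> {1..k} \<and> \<not> h l"
      "Neg (z, l) \<in> D \<longleftrightarrow> z \<in> {x, y} \<and> l \<in> {1..k} \<and> h l" for z l
      by (auto simp: D_def BPHP_clause_def lit_neq_def image_iff)
    have "negate lit \<in> D \<inter> negate ` L"
      using lit v xb(2) nt L by (cases lit) (auto simp: inD h_def in_negate_image)
    moreover have "D \<inter> L = {}"
    proof -
      have "Pos (z, l) \<notin> D \<inter> L" "Neg (z, l) \<notin> D \<inter> L" for z l
        using nt[of "(z, l)"] L(2) noty[of l] by (auto simp: inD h_def)
      then have "l \<notin> L" if "l \<in> D" for l
        using that by (metis IntI literal.exhaust prod.exhaust)
      then show ?thesis by auto
    qed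
    moreover have "\<not> tautological ((C - L) \<union> (D - negate ` L))"
    proof -
      let ?X = "(C - L) \<union> (D - negate ` L)"
      have *: "\<not> (Pos v \<in> ?X \<and> Neg v \<in> ?X)" for v
        using nt noty by (cases v) (auto simp: inD h_def in_negate_image)
      have "negate l \<notin> ?X" if "l \<in> ?X" for l
        using that *[of "var l"] by (cases l) (simp_all del: Un_iff Diff_iff)
      then show ?thesis
        unfolding tautological_def by blast
    qed
    ultimately show False
      using block[OF D] by blast
  qed
qed

section \<open>Proof steps and the soundness of narrow clauses\<close>

lemma SBC_proof_mono:
  assumes "SBC_proof \<Gamma> P" "j < length P" "i \<le> j"
  shows "P ! i \<subseteq> P ! j"
  using assms(3,2)
proof (induction j rule: dec_induct)
  case (step j)
  then have "SBC_step (P ! j) (P ! Suc j)"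
    using assms(1) by (simp add: SBC_proof_def)
  then have "P ! j \<subseteq> P ! Suc j"
    by (auto simp: SBC_step_def)
  then show ?case
    using step by simp
qed simp

lemma SBC_proof_first: "SBC_proof \<Gamma> P \<Longrightarrow> P ! 0 = \<Gamma>"
  unfolding SBC_proof_def by (metis hd_conv_nth)

text \<open>A step adds at most one clause. Leaving out the axioms bounds the count by the proof
  length alone.\<close>

lemma card_derived_clauses:
  assumes "SBC_proof \<Gamma> P" "i < length P"
  shows "finite (P ! i - \<Gamma>) \<and> card (P ! i - \<Gamma>) \<le> i"
  using assms(2)
proof (induction i)
  case 0
  then show ?case
    using SBC_proof_first[OF assms(1)] by simp
next
  case (Suc i)
  then have "SBC_step (P ! i) (P ! Suc i)"
    using assms(1) by (simp add: SBC_proof_def)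
  then obtain C where "P ! Suc i = P ! i \<union> {C}"
    by (auto simp: SBC_step_def)
  then have "P ! Suc i - \<Gamma> \<subseteq> insert C (P ! i - \<Gamma>)"
    by auto
  moreover have "finite (insert C (P ! i - \<Gamma>))" "card (insert C (P ! i - \<Gamma>)) \<le> Suc i"
    using Suc by (auto simp: card_insert_if)
  ultimately show ?case
    by (meson card_mono finite_subset le_trans)
qed

lemma falsifies_weakening: "falsifies a D \<Longrightarrow> C \<subseteq> D \<Longrightarrow> falsifies a C"
  by (auto simp: falsifies_def)

text \<open>The bit that \<open>H\<close> assigns to \<open>v\<close> falsifies one of the two
  resolved literals and thereby selects the parent.\<close>

lemma falsifies_resolvent:
  assumes "falsifies a (C \<union> D)" "a (fst v) = Some H"
  shows "falsifies a (C \<union> {Pos v}) \<or> falsifies a (D \<union> {Neg v})"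
  using assms by (cases "snd v \<in> H") (auto simp: falsifies_def)

text \<open>The threshold \<open>w\<close> separates wide from narrow clauses. The bound on
  \<open>card (dom r) + w\<close> leaves a free hole in the resolution case;
  \<open>w \<le> 2 ^ k\<close> makes set-blocked clauses wide, as they mention all
  \<open>2 ^ k + 1\<close> pigeons. The induction ranges over all extensions \<open>a\<close> of
  \<open>r\<close> because the resolution case changes the matching.\<close>

lemma narrow_proof_not_falsified:
  assumes proof_P: "SBC_minus_proof (BPHP_pow k) P" and k: "k \<ge> 1"
    and r: "matching k r" "card (dom r) + w \<le> 2 ^ k" "w \<le> 2 ^ k"
    and wide: "\<And>\<Delta> C. \<Delta> \<in> set P \<Longrightarrow> C \<in> \<Delta> - BPHP_pow k \<Longrightarrow> w \<le> card (pigeons C) \<Longrightarrow>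
      satisfies r C"
    and "i < length P" "C \<in> P ! i" "matching k a" "r \<subseteq>\<^sub>m a"
  shows "\<not> falsifies a C"
  using assms(7-)
proof (induction i arbitrary: C a)
  case 0
  then show ?case
    using SBC_proof_first[of "BPHP_pow k" P] proof_P matching_not_falsifies_axiom k
    by (auto simp: SBC_minus_proof_def)
next
  case (Suc i)
  have P: "SBC_proof (BPHP_pow k) P"
    using proof_P by (simp add: SBC_minus_proof_def)
  have vars: "var ` A \<subseteq> {1..2 ^ k + 1} \<times> {1..k}" if "A \<in> P ! j" "j < length P" for A j
    using that proof_P vars_BPHP_pow[of k] nth_mem[of j P]
    unfolding SBC_minus_proof_def vars_def by blast
  have sub: "BPHP_pow k \<subseteq> P ! i"
    using SBC_proof_mono[OF P, of i 0] SBC_proof_first[OF P] Suc.prems by simp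
  have IH: "\<not> falsifies b A" if "A \<in> P ! i" "matching k b" "r \<subseteq>\<^sub>m b" for A b
    using Suc.IH[of A b] Suc.prems that by simp
  show ?case
  proof (cases "C \<in> P ! i")
    case True
    then show ?thesis
      using IH Suc.prems by blast
  next
    case False
    show ?thesis
    proof
      assume f: "falsifies a C"
      have "\<not> satisfies r C"
        using not_satisfies_if_falsifies[OF f] Suc.prems by simp
      then have narrow: "card (pigeons C) < w"
        using wide[of "P ! Suc i" C] Suc.prems False sub by (meson Diff_iff not_less nth_mem subsetD)
      have "SBC_step (P ! i) (P ! Suc i)"
        using P Suc.prems by (simp add: SBC_proof_def)
      with False Suc.prems consider A B where "A \<in> P ! i" "B \<in> P ! i" "resolvent C A B"
        | A where "A \<in> P ! i" "weakening C A" | "set_blocked C (P ! i)"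
        by (auto simp: SBC_step_def)
      then show False
      proof cases
        case (1 A B)
        then obtain v E F where AB: "A = E \<union> {Pos v}" "B = F \<union> {Neg v}" "C = E \<union> F"
          and cl: "is_clause A" "is_clause B"
          by (auto simp: resolvent_def)
        have finC: "finite (pigeons C)"
          using cl AB by (intro finite_pigeons) (auto simp: is_clause_def)
        have x: "fst v \<in> {1..2 ^ k + 1}"
          using vars[of A i] 1 AB Suc.prems by (auto simp: mem_Times_iff)
        text \<open>Forgetting the pigeons that \<open>C\<close> does not need frees a hole for the pigeon of \<open>v\<close>.\<close>
        define b where "b = a |` (dom r \<union> pigeons C)"
        have b: "matching k b" "falsifies b C" "r \<subseteq>\<^sub>m b"
          using Suc.prems(3,4) f
          by (auto simp: b_def matching_restrict falsifies_restrict map_le_def)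
        have "card (dom b) \<le> card (dom r \<union> pigeons C)"
          using finC finite_dom_matching[OF r(1)] by (intro card_mono) (auto simp: b_def)
        also have "\<dots> \<le> card (dom r) + card (pigeons C)"
          by (rule card_Un_le)
        finally have "card (dom b) < 2 ^ k"
          using narrow r(2) by simp
        then obtain H where H: "H \<in> Pow {1..k}" "H \<notin> ran b"
          using ex_free_hole[OF b(1)] by blast
        define d where "d = (if fst v \<in> dom b then b else b(fst v \<mapsto> H))"
        have d: "matching k d" "b \<subseteq>\<^sub>m d" "fst v \<in> dom d"
          using b(1) matching_upd[OF b(1) x _ H] by (auto simp: d_def map_le_def)
        then obtain G where "d (fst v) = Some G"
          by auto
        then have "falsifies d A \<or> falsifies d B"
          using falsifies_resolvent[of d E F v G] falsifies_mono[OF b(2) d(2)] AB by simp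
        then show False
          using IH[of _ d] 1 d map_le_trans[OF b(3) d(2)] by blast
      next
        case (2 A)
        then have "falsifies a A"
          using f falsifies_weakening by (auto simp: weakening_def)
        then show False
          using IH 2 Suc.prems by blast
      next
        case 3
        have "{1..2 ^ k + 1} \<subseteq> pigeons C"
          using pigeons_set_blocked[OF 3 sub] vars Suc.prems by blast
        moreover have "finite (pigeons C)"
          using 3 finite_pigeons unfolding set_blocked_def set_blocked_for_def is_clause_def by blast
        ultimately have "2 ^ k + 1 \<le> card (pigeons C)"
          using card_mono[of "pigeons C" "{1..2 ^ k + 1}"] by simp
        then show False
          using narrow r(3) by simp
      qed
    qed
  qed
qed

section \<open>Greedy choice of a matching that satisfies the wide clauses\<close>

lemma card_sat_holes:
  assumes "snd (var l) \<in> {1..k}"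
  shows "2 ^ (k - 1) \<le> card {H \<in> Pow {1..k}. sat_lit H l}"
proof -
  let ?b = "snd (var l)" and ?A = "Pow ({1..k} - {snd (var l)})"
  have card: "card ?A = 2 ^ (k - 1)"
    using assms by (simp add: card_Pow)
  have fin: "finite {H \<in> Pow {1..k}. sat_lit H l}"
    by simp
  show ?thesis
  proof (cases l)
    case (Pos v)
    \<comment> \<open>Inserting the bit maps the holes avoiding it injectively to holes containing
      it.\<close>
    have "card (insert ?b ` ?A) = card ?A"
      by (intro card_image inj_onI) (auto dest: insert_ident[THEN iffD1, rotated 2])
    moreover have "insert ?b ` ?A \<subseteq> {H \<in> Pow {1..k}. sat_lit H l}"
      using assms Pos by auto
    ultimately show ?thesis
      using card card_mono[OF fin, of "insert ?b ` ?A"] by simp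
  next
    case (Neg v)
    then have "?A \<subseteq> {H \<in> Pow {1..k}. sat_lit H l}"
      by auto
    then show ?thesis
      using card card_mono[OF fin, of ?A] by simp
  qed
qed

text \<open>Double counting of clauses against pairs of an unassigned pigeon and a free hole. A wide
  clause keeps at least \<open>q\<close> unassigned pigeons; for each, at least \<open>2 * q\<close>
  holes satisfy one of its literals and fewer than \<open>q\<close> are taken. So at least
  \<open>q * q\<close> of at most \<open>32 * (q * q)\<close> pairs satisfy it, and some pair
  reaches the average.\<close>

lemma greedy_step:
  assumes k: "2 ^ k = 4 * q" and r: "matching k r" "card (dom r) < q" and S: "finite S"
    and C: "\<And>C. C \<in> S \<Longrightarrow> finite C \<and> var ` C \<subseteq> {1..2 ^ k + 1} \<times> {1..k} \<and> 2 * q \<le> card (pigeons C)"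
  obtains x H where "matching k (r(x \<mapsto> H))" "x \<notin> dom r"
    "card S \<le> 32 * card {C \<in> S. \<exists>l\<in>C. fst (var l) = x \<and> sat_lit H l}"
proof -
  define U where "U = {1..2 ^ k + 1} - dom r"
  define F where "F = Pow {1..k} - ran r"
  define hit where "hit C x H \<longleftrightarrow> (\<exists>l\<in>C. fst (var l) = x \<and> sat_lit H l)"
    for C :: "(nat \<times> nat) clause" and x H
  have fin: "finite (dom r)" "finite (ran r)" "card (ran r) < q"
    using finite_dom_matching[OF r(1)] card_ran_le_dom[of r] r(2) by auto
  have half: "2 ^ (k - 1) = 2 * q"
    using k r(2) by (cases k) auto
  have pair: "q * q \<le> card {p \<in> U \<times> F. hit C (fst p) (snd p)}" if "C \<in> S" for C
  proof -
    have holes: "q \<le> card {H \<in> F. hit C x H}" if x: "x \<in> pigeons C" for x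
    proof -
      obtain l where l: "l \<in> C" "fst (var l) = x"
        using x by (auto simp: pigeons_def)
      have "snd (var l) \<in> {1..k}"
        using C[OF \<open>C \<in> S\<close>] imageI[OF l(1), of var] mem_Times_iff[of "var l"] by blast
      then have "2 * q \<le> card {H \<in> Pow {1..k}. sat_lit H l}"
        using card_sat_holes half by metis
      then have "q \<le> card ({H \<in> Pow {1..k}. sat_lit H l} - ran r)"
        using diff_card_le_card_Diff[OF fin(2), of "{H \<in> Pow {1..k}. sat_lit H l}"] fin(3) by linarith
      also have "\<dots> \<le> card {H \<in> F. hit C x H}"
        using l by (intro card_mono) (auto simp: F_def hit_def)
      finally show ?thesis .
    qed
    have "pigeons C \<subseteq> {1..2 ^ k + 1}"
      using C[OF \<open>C \<in> S\<close>] unfolding pigeons_def by fastforce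
    then have UC: "U \<inter> pigeons C = pigeons C - dom r"
      by (auto simp: U_def)
    have "2 * q \<le> card (pigeons C)"
      using C[OF \<open>C \<in> S\<close>] by blast
    then have "q \<le> card (U \<inter> pigeons C)"
      using diff_card_le_card_Diff[OF fin(1), of "pigeons C"] r(2) unfolding UC by linarith
    then have "q * q \<le> card (U \<inter> pigeons C) * q"
      by simp
    also have "\<dots> \<le> (\<Sum>x\<in>U \<inter> pigeons C. card {H \<in> F. hit C x H})"
      using holes sum_bounded_below[of "U \<inter> pigeons C" q] by simp
    also have "\<dots> = card (SIGMA x : U \<inter> pigeons C. {H \<in> F. hit C x H})"
      by (rule card_SigmaI[symmetric]) (auto simp: U_def F_def)
    also have "\<dots> \<le> card {p \<in> U \<times> F. hit C (fst p) (snd p)}"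
      by (intro card_mono) (auto simp: U_def F_def)
    finally show ?thesis .
  qed
  have finUF: "finite (U \<times> F)"
    by (simp add: U_def F_def)
  have cardUF: "card (U \<times> F) \<le> 32 * (q * q)"
  proof -
    have "card U \<le> card {1..2 ^ k + 1 :: nat}"
      unfolding U_def by (rule card_mono) auto
    moreover have "card F \<le> card (Pow {1..k})"
      unfolding F_def by (rule card_mono) auto
    \<comment> \<open>The \<open>4 * q + 1\<close> pigeons are rounded up to \<open>8 * q\<close>,
      as \<open>q\<close> is positive.\<close>
    ultimately have "card U \<le> 8 * q" "card F \<le> 4 * q"
      using k r(2) by (auto simp: card_Pow)
    then have "card U * card F \<le> (8 * q) * (4 * q)"
      by (rule mult_le_mono)
    then show ?thesis
      by (simp add: card_cartesian_product)
  qed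
  \<comment> \<open>A pair must exist even if \<open>S\<close> is empty; this also makes the
    averaging inequality strict.\<close>
  have ne: "U \<times> F \<noteq> {}"
  proof -
    have "\<not> {1..2 ^ k + 1} \<subseteq> dom r"
      using card_mono[OF fin(1), of "{1..2 ^ k + 1}"] r(2) k by auto
    moreover have "card (dom r) < 2 ^ k"
      using k r(2) by simp
    ultimately show ?thesis
      using ex_free_hole[OF r(1)] by (auto simp: U_def F_def)
  qed
  obtain p where p: "p \<in> U \<times> F" "card S \<le> 32 * card {C \<in> S. hit C (fst p) (snd p)}"
  proof (rule ccontr)
    assume "\<not> thesis"
    with that have less: "32 * card {C \<in> S. hit C (fst p) (snd p)} < card S" if "p \<in> U \<times> F" for p
      using that by force
    have "card S * (32 * (q * q)) \<le> 32 * (\<Sum>C\<in>S. card {p \<in> U \<times> F. hit C (fst p) (snd p)})"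
      using pair sum_bounded_below[of S "q * q"] by simp
    also have "\<dots> = (\<Sum>p\<in>U \<times> F. 32 * card {C \<in> S. hit C (fst p) (snd p)})"
      unfolding sum_distrib_left[symmetric]
      using sum_multicount_gen[OF S finUF, of "\<lambda>C p. hit C (fst p) (snd p)"] by simp
    also have "\<dots> < (\<Sum>p\<in>U \<times> F. card S)"
      using less finUF ne by (intro sum_strict_mono) auto
    also have "\<dots> \<le> card S * (32 * (q * q))"
      using cardUF by simp
    finally show False
      by simp
  qed
  show ?thesis
  proof (rule that)
    show "matching k (r(fst p \<mapsto> snd p))" "fst p \<notin> dom r"
      using p(1) by (auto simp: U_def F_def intro!: matching_upd[OF r(1)])
    show "card S \<le> 32 * card {C \<in> S. \<exists>l\<in>C. fst (var l) = fst p \<and> sat_lit (snd p) l}"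
      using p(2) by (simp add: hit_def)
  qed
qed

text \<open>Each greedy step is applied to the clauses not yet satisfied and leaves at most
  \<open>31/32\<close> of them.\<close>

lemma greedy_matching:
  assumes k: "2 ^ k = 4 * q" and S: "finite S"
    and C: "\<And>C. C \<in> S \<Longrightarrow> finite C \<and> var ` C \<subseteq> {1..2 ^ k + 1} \<times> {1..k} \<and> 2 * q \<le> card (pigeons C)"
    and "t \<le> q"
  shows "\<exists>r. matching k r \<and> card (dom r) = t \<and>
    real (card {C \<in> S. \<not> satisfies r C}) \<le> (31/32) ^ t * real (card S)"
  using \<open>t \<le> q\<close>
proof (induction t)
  case 0
  have "card {C \<in> S. \<not> satisfies Map.empty C} \<le> card S"
    using S by (intro card_mono) auto
  then show ?case
    by (intro exI[of _ Map.empty]) (auto simp: matching_def)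
next
  case (Suc t)
  then obtain r where r: "matching k r" "card (dom r) = t"
    and surv: "real (card {C \<in> S. \<not> satisfies r C}) \<le> (31/32) ^ t * real (card S)"
    by auto
  let ?T = "{C \<in> S. \<not> satisfies r C}"
  have T: "finite ?T"
    using S by simp
  obtain x H where xH: "matching k (r(x \<mapsto> H))" "x \<notin> dom r"
    and hit: "card ?T \<le> 32 * card {C \<in> ?T. \<exists>l\<in>C. fst (var l) = x \<and> sat_lit H l}" (is "_ \<le> 32 * card ?K")
  proof (rule greedy_step[OF k r(1) _ T])
    show "card (dom r) < q"
      using r(2) Suc.prems by simp
  qed (use C in auto)
  have "{C \<in> S. \<not> satisfies (r(x \<mapsto> H)) C} = ?T - ?K"
    using xH(2) by (auto simp: satisfies_upd domIff)
  moreover have "card (?T - ?K) = card ?T - card ?K" "card ?K \<le> card ?T"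
    using T by (auto intro!: card_Diff_subset card_mono elim: rev_finite_subset)
  ultimately have "real (card {C \<in> S. \<not> satisfies (r(x \<mapsto> H)) C}) \<le> 31/32 * real (card ?T)"
    using hit by (simp add: of_nat_diff)
  also have "\<dots> \<le> (31/32) ^ Suc t * real (card S)"
    using surv by simp
  finally show ?case
    using xH finite_dom_matching[OF r(1)] r(2)
    by (intro exI[of _ "r(x \<mapsto> H)"]) (simp del: fun_upd_apply)
qed

section \<open>The size lower bound\<close>

lemma SBC_minus_BPHP_pow_size:
  assumes P: "SBC_minus_proof (BPHP_pow k) P" and k: "2 ^ k = 4 * q"
  shows "(32/31) ^ q \<le> real (length P)"
proof (rule ccontr)
  assume short: "\<not> (32/31) ^ q \<le> real (length P)"
  have SP: "SBC_proof (BPHP_pow k) P"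
    using P by (simp add: SBC_minus_proof_def)
  then have ne: "P \<noteq> []" and bot: "{} \<in> last P"
    by (auto simp: SBC_proof_def)
  define j where "j = length P - 1"
  have j: "j < length P" "P ! j = last P"
    using ne by (auto simp: j_def last_conv_nth)
  \<comment> \<open>Formulas only grow, so the last one contains every wide derived clause of the
    proof.\<close>
  define S where "S = {C \<in> last P - BPHP_pow k. 2 * q \<le> card (pigeons C)}"
  have "S \<subseteq> last P - BPHP_pow k"
    by (auto simp: S_def)
  then have "finite S" and "card S \<le> j"
    using card_derived_clauses[OF SP j(1)] j(2) card_mono[of "last P - BPHP_pow k" S]
      finite_subset[of S "last P - BPHP_pow k"] by auto
  have q: "q \<ge> 1" "k \<ge> 1"
    using k by (cases q; cases k; force)+
  have C: "finite C \<and> var ` C \<subseteq> {1..2 ^ k + 1} \<times> {1..k} \<and> 2 * q \<le> card (pigeons C)" if "C \<in> S" for C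
  proof -
    have "var ` C \<subseteq> vars (BPHP_pow k)"
      using that P last_in_set[OF ne] unfolding S_def SBC_minus_proof_def vars_def by blast
    moreover have "finite C" if "finite (var ` C)"
    proof -
      have "C \<subseteq> Pos ` var ` C \<union> Neg ` var ` C"
        by (auto simp: image_iff) (metis literal.exhaust_sel)
      then show ?thesis
        using that by (meson finite_UnI finite_imageI finite_subset)
    qed
    ultimately show ?thesis
      using that vars_BPHP_pow[of k] finite_subset[of "var ` C" "{1..2 ^ k + 1} \<times> {1..k}"]
      by (auto simp: S_def)
  qed
  obtain r where r: "matching k r" "card (dom r) = q"
    and surv: "real (card {C \<in> S. \<not> satisfies r C}) \<le> (31/32) ^ q * real (card S)"
    using greedy_matching[OF k \<open>finite S\<close> C order_refl] by blast
  \<comment> \<open>Fewer than \<open>(32/31) ^ q\<close> clauses at the start leave fewer than one,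
    hence none, after \<open>q\<close> steps.\<close>
  have "(31/32) ^ q * real (card S) < (31/32) ^ q * (32/31) ^ q"
    using short \<open>card S \<le> j\<close> j(1) by (intro mult_strict_left_mono) auto
  also have "\<dots> = (1::real)"
    by (simp flip: power_mult_distrib)
  finally have "card {C \<in> S. \<not> satisfies r C} = 0"
    using surv by linarith
  then have all_sat: "\<forall>C\<in>S. satisfies r C"
    using \<open>finite S\<close> by simp
  have wide: "satisfies r C"
    if \<Delta>: "\<Delta> \<in> set P" and C: "C \<in> \<Delta> - BPHP_pow k" "2 * q \<le> card (pigeons C)" for \<Delta> C
  proof -
    obtain i where "i < length P" "\<Delta> = P ! i"
      using \<Delta> unfolding in_set_conv_nth by blast
    then have "\<Delta> \<subseteq> last P"
      using SBC_proof_mono[OF SP j(1), of i] j by (simp add: j_def)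
    then show ?thesis
      using C all_sat by (auto simp: S_def)
  qed
  \<comment> \<open>With \<open>w = 2 * q\<close> the matching and a narrow clause together involve
    fewer than \<open>3 * q\<close> pigeons, below the \<open>4 * q\<close> holes.\<close>
  have "\<not> falsifies r {}"
    using narrow_proof_not_falsified[OF P q(2) r(1), of "2 * q" j "{}" r] wide j bot r k by simp
  then show False
    by (simp add: falsifies_def)
qed

theorem theorem1:
  shows "\<exists>c::real. c > 0 \<and> (\<exists>n0::nat. \<forall>n\<ge>n0. n \<ge> 2 \<longrightarrow>
    (\<forall>P. SBC_minus_proof (BPHP n) P \<longrightarrow> real (length P) \<ge> 2 powr (c * real n)))"
proof (intro exI conjI allI impI)
  \<comment> \<open>The constant comes from \<open>(32/31) ^ q = 2 powr (log 2 (32/31) * q)\<close>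
    and \<open>n < 2 ^ (k + 1) = 8 * q\<close>.\<close>
  show "log 2 (32/31) / 8 > (0::real)"
    by simp
  fix n :: nat and P
  \<comment> \<open>The threshold \<open>n0\<close> is 4, so that \<open>k \<ge> 2\<close> and
    \<open>2 ^ k\<close> is divisible by 4.\<close>
  assume n: "4 \<le> n" and P: "SBC_minus_proof (BPHP n) P"
  define k where "k = floor_log n"
  have "2 \<le> k"
    using floor_log_mono[THEN monoD, OF n] floor_log_power[of 2] by (simp add: k_def)
  then obtain j where j: "k = j + 2"
    by (metis add.commute le_Suc_ex)
  define q :: nat where "q = 2 ^ j"
  have q: "2 ^ k = 4 * q"
    by (simp add: j q_def power_add)
  have "n < 8 * q"
    using floor_log_exp2_gt[of n] q by (simp add: k_def)
  then have "2 powr (log 2 (32/31) / 8 * real n) \<le> 2 powr (log 2 (32/31) * real q)"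
    by simp
  also have "\<dots> = (32/31) ^ q"
    by (simp add: powr_powr[symmetric] powr_realpow)
  also have "\<dots> \<le> real (length P)"
    using SBC_minus_BPHP_pow_size[OF _ q] P by (simp add: BPHP_def k_def)
  finally show "2 powr (log 2 (32/31) / 8 * real n) \<le> real (length P)" .
qed

end
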